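(* Let $X$ be a Hilbert space, let $\mathbf{\Omega}=\{\Omega_1,\Omega_2\}$ be a collection of two subsets of $X$, and let $\bar x\in\Omega_1\cap\Omega_2$. Then the following relations hold true: (i) $(\hat\eta[\mathbf{\Omega}](\bar x))^2+(\hat\nu[\mathbf{\Omega}](\bar x))^2=1$; (ii) $1+\hat c[\mathbf{\Omega}](\bar x)=2(\hat\nu[\mathbf{\Omega}](\bar x))^2$.
   Context: $X^*$ is identified with the Hilbert space $X$; $B_\delta(x)$ is the closed ball with center $x$ and radius $\delta$. For $\Omega\subset X$ and $x\in\Omega$, the Fréchet normal cone is $N_\Omega(x)=\{x^*\in X\mid\limsup_{y\to x,\,y\in\Omega}\frac{\langle x^*,y-x\rangle}{\|y-x\|}\le0\}$ (equal to $X$ if $x$ is isolated in $\Omega$). For $\bar x\in\Omega$ and $\delta\ge0$, $\widehat N_\Omega(\bar x,\delta)=\bigcup_{x\in\Omega\cap B_\delta(\bar x)}N_\Omega(x)$. Constants: $$\hat\eta[\mathbf{\Omega}](\bar x)=\lim_{\delta\downarrow0}\inf\{\|x_1^*+x_2^*\|\mid x_i^*\in\widehat N_{\Omega_i}(\bar x,\delta)\ (i=1,2),\ \|x_1^*\|+\|x_2^*\|=1\},$$ where the infimum over the empty set equals $1$; $$\hat c[\mathbf{\Omega}](\bar x)=1-2(\hat\eta[\mathbf{\Omega}](\bar x))^2;$$ $$\hat\nu[\mathbf{\Omega}](\bar x)=\lim_{\delta\downarrow0}\sup\left\{\|x_1^*-x_2^*\|\ \middle|\ x_i^*\in\widehat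 N_{\Omega_i}(\bar x,\delta),\ \|x_i^*\|=\tfrac12\ (i=1,2)\right\},$$ where the supremum over the empty set equals $0$. *)

theory Defs
  imports "HOL-Analysis.Analysis"
begin

text \<open>
  A Hilbert space is a type of sort \<open>{real_inner, complete_space}\<close>; its dual is identified
  with the space itself.
\<close>

text \<open>
  The cone is only meaningful for \<open>x \<in> \<Omega>\<close>. The filter \<open>at x within \<Omega>\<close> excludes \<open>y = x\<close>; if \<open>x\<close>
  is isolated in \<open>\<Omega>\<close> it is the bottom filter, the upper limit is \<open>-\<infinity>\<close>, and the cone is the
  whole space.
\<close>

definition frechet_normal_cone :: "'a::real_inner set \<Rightarrow> 'a \<Rightarrow> 'a set" where
  "frechet_normal_cone \<Omega> x =
     {x'. Limsup (at x within \<Omega>) (\<lambda>y. ereal (inner x' (y - x) / norm (y - x))) \<le> 0}"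

definition normals_near :: "'a::real_inner set \<Rightarrow> 'a \<Rightarrow> real \<Rightarrow> 'a set" where
  "normals_near \<Omega> xb \<delta> = (\<Union>x \<in> \<Omega> \<inter> cball xb \<delta>. frechet_normal_cone \<Omega> x)"

text \<open>
  The value of the infimum (supremum) over the empty set is fixed explicitly, since \<open>Inf {}\<close>
  and \<open>Sup {}\<close> are unspecified in the reals. All the sets below are contained in the interval
  from 0 to 1, and the functions of \<open>\<delta>\<close> are monotone, so the one-sided limits exist.
\<close>

definition eta_set :: "'a::real_inner set \<Rightarrow> 'a set \<Rightarrow> 'a \<Rightarrow> real \<Rightarrow> real set" where
  "eta_set \<Omega>1 \<Omega>2 xb \<delta> =
     {norm (x1 + x2) | x1 x2. x1 \<in> normals_near \<Omega>1 xb \<delta> \<and> x2 \<in> normals_near \<Omega>2 xb \<delta> \<and>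
        norm x1 + norm x2 = 1}"

definition eta_hat :: "'a::real_inner set \<Rightarrow> 'a set \<Rightarrow> 'a \<Rightarrow> real" where
  "eta_hat \<Omega>1 \<Omega>2 xb =
     Lim (at_right 0)
       (\<lambda>\<delta>. if eta_set \<Omega>1 \<Omega>2 xb \<delta> = {} then 1 else Inf (eta_set \<Omega>1 \<Omega>2 xb \<delta>))"

definition c_hat :: "'a::real_inner set \<Rightarrow> 'a set \<Rightarrow> 'a \<Rightarrow> real" where
  "c_hat \<Omega>1 \<Omega>2 xb = 1 - 2 * (eta_hat \<Omega>1 \<Omega>2 xb)\<^sup>2"

definition nu_set :: "'a::real_inner set \<Rightarrow> 'a set \<Rightarrow> 'a \<Rightarrow> real \<Rightarrow> real set" where
  "nu_set \<Omega>1 \<Omega>2 xb \<delta> =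
     {norm (x1 - x2) | x1 x2. x1 \<in> normals_near \<Omega>1 xb \<delta> \<and> x2 \<in> normals_near \<Omega>2 xb \<delta> \<and>
        norm x1 = 1 / 2 \<and> norm x2 = 1 / 2}"

definition nu_hat :: "'a::real_inner set \<Rightarrow> 'a set \<Rightarrow> 'a \<Rightarrow> real" where
  "nu_hat \<Omega>1 \<Omega>2 xb =
     Lim (at_right 0)
       (\<lambda>\<delta>. if nu_set \<Omega>1 \<Omega>2 xb \<delta> = {} then 0 else Sup (nu_set \<Omega>1 \<Omega>2 xb \<delta>))"

end

theory Submission
  imports Defs
begin

text \<open>
  For vectors \<open>u\<close>, \<open>v\<close> of norm \<open>1/2\<close> the parallelogram law gives
  \<open>\<parallel>u + v\<parallel>\<^sup>2 + \<parallel>u - v\<parallel>\<^sup>2 = 1\<close>, and among the combinations \<open>2 s u + 2 t v\<close> with \<open>s, t \<ge> 0\<close>,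
  \<open>s + t = 1\<close>, the norm is least at \<open>s = t = 1/2\<close>. As normal cones are closed under positive
  scaling, the identity therefore holds for the infimum and the supremum at every fixed \<open>\<delta>\<close>,
  and it passes to the limit because the supremum is monotone in \<open>\<delta>\<close>.
\<close>

text \<open>Scaling by \<open>c\<close> multiplies every difference quotient by \<open>c\<close>, so
  a bound \<open>r\<close> for the scaled quotients amounts to the bound \<open>r / c\<close> for
  the original ones.\<close>

lemma frechet_normal_cone_scaleR:
  assumes "v \<in> frechet_normal_cone \<Omega> x" and "c > 0"
  shows "c *\<^sub>R v \<in> frechet_normal_cone \<Omega> x"
proof -
  let ?f = "\<lambda>y. ereal (inner v (y - x) / norm (y - x))"
  have "Limsup (at x within \<Omega>) (\<lambda>y. ereal (inner (c *\<^sub>R v) (y - x) / norm (y - x))) \<le> 0"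
    unfolding Limsup_le_iff
  proof (intro allI impI)
    fix e :: ereal
    assume "e > 0"
    \<comment> \<open>\<open>e\<close> may be infinite; a real \<open>r\<close> below it can be
      divided by \<open>c\<close>.\<close>
    then obtain r where r: "0 < r" "ereal r < e"
      by (metis ereal_dense2 ereal_less(2) zero_ereal_def)
    have "Limsup (at x within \<Omega>) ?f \<le> 0"
      using assms(1) by (simp add: frechet_normal_cone_def)
    moreover have "0 < ereal (r / c)"
      using r \<open>c > 0\<close> by simp
    ultimately have "\<forall>\<^sub>F y in at x within \<Omega>. ?f y < ereal (r / c)"
      unfolding Limsup_le_iff by blast
    then show "\<forall>\<^sub>F y in at x within \<Omega>. ereal (inner (c *\<^sub>R v) (y - x) / norm (y - x)) < e"
    proof eventually_elim
      case (elim y)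
      then have "c * (inner v (y - x) / norm (y - x)) < r"
        using \<open>c > 0\<close> by (simp add: pos_less_divide_eq mult.commute)
      then have "ereal (inner (c *\<^sub>R v) (y - x) / norm (y - x)) < ereal r"
        by simp
      then show ?case
        using r(2) by (rule less_trans)
    qed
  qed
  then show ?thesis
    by (simp add: frechet_normal_cone_def)
qed

lemma normals_near_scaleR:
  "v \<in> normals_near \<Omega> xb \<delta> \<Longrightarrow> c > 0 \<Longrightarrow> c *\<^sub>R v \<in> normals_near \<Omega> xb \<delta>"
  by (auto simp: normals_near_def intro: frechet_normal_cone_scaleR)

lemma normals_near_mono:
  "\<delta> \<le> \<delta>' \<Longrightarrow> normals_near \<Omega> xb \<delta> \<subseteq> normals_near \<Omega> xb \<delta>'"
  by (force simp: normals_near_def)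

lemma nu_set_mono:
  "\<delta> \<le> \<delta>' \<Longrightarrow> nu_set \<Omega>1 \<Omega>2 xb \<delta> \<subseteq> nu_set \<Omega>1 \<Omega>2 xb \<delta>'"
  unfolding nu_set_def using normals_near_mono by blast

lemma nu_set_bounds:
  assumes "b \<in> nu_set \<Omega>1 \<Omega>2 xb \<delta>"
  shows "0 \<le> b" and "b \<le> 1"
proof -
  obtain u v :: 'a where uv: "b = norm (u - v)" "norm u = 1 / 2" "norm v = 1 / 2"
    using assms by (auto simp: nu_set_def)
  show "0 \<le> b" "b \<le> 1"
    using uv norm_triangle_ineq4[of u v] by simp_all
qed

lemma bdd_above_nu_set: "bdd_above (nu_set \<Omega>1 \<Omega>2 xb \<delta>)"
  using nu_set_bounds(2) by (rule bdd_aboveI)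

lemma eta_set_nonneg: "a \<in> eta_set \<Omega>1 \<Omega>2 xb \<delta> \<Longrightarrow> 0 \<le> a"
  by (auto simp: eta_set_def)

lemma norm_add_half_square:
  fixes u v :: "'a::real_inner"
  assumes "norm u = 1 / 2" "norm v = 1 / 2"
  shows "(norm (u + v))\<^sup>2 + (norm (u - v))\<^sup>2 = 1"
proof -
  have "inner u u = 1 / 4" "inner v v = 1 / 4"
    unfolding dot_square_norm assms by (simp_all add: power_divide)
  then show ?thesis
    by (simp add: power2_norm_eq_inner inner_add inner_diff inner_commute[of v u])
qed

text \<open>With \<open>r = inner u v\<close>, the right side exceeds the left by
  \<open>2 * (1 / 4 - r) * (2 * s - 1)\<^sup>2\<close>, and \<open>r \<le> 1 / 4\<close> by
  Cauchy-Schwarz. The left side is the square of \<open>norm (u + v)\<close>, written through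
  \<open>u - v\<close> so that members of \<open>nu_set\<close> appear directly.\<close>

lemma norm_convex_combination_ge:
  fixes u v :: "'a::real_inner"
  assumes uv: "norm u = 1 / 2" "norm v = 1 / 2" and "s + t = 1"
  shows "1 - (norm (u - v))\<^sup>2 \<le> (norm ((2 * s) *\<^sub>R u + (2 * t) *\<^sub>R v))\<^sup>2"
proof -
  define r where "r = inner u v"
  have uu: "inner u u = 1 / 4" "inner v v = 1 / 4"
    unfolding dot_square_norm uv by (simp_all add: power_divide)
  have "r \<le> 1 / 4"
    using norm_cauchy_schwarz[of u v] uv by (simp add: r_def)
  have t: "t = 1 - s"
    using \<open>s + t = 1\<close> by simp
  have "(norm ((2 * s) *\<^sub>R u + (2 * t) *\<^sub>R v))\<^sup>2 = s\<^sup>2 + t\<^sup>2 + 8 * s * t * r"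
    unfolding power2_norm_eq_inner
    by (simp add: inner_add uu r_def inner_commute[of v u] power2_eq_square distrib_left)
  moreover have "(norm (u - v))\<^sup>2 = 1 / 2 - 2 * r"
    by (simp add: power2_norm_eq_inner inner_diff uu r_def inner_commute[of v u])
  moreover have "s\<^sup>2 + t\<^sup>2 + 8 * s * t * r - (1 - (1 / 2 - 2 * r)) = 2 * (1 / 4 - r) * (2 * s - 1)\<^sup>2"
    by (simp add: t power2_eq_square algebra_simps)
  moreover have "0 \<le> 2 * (1 / 4 - r) * (2 * s - 1)\<^sup>2"
    using \<open>r \<le> 1 / 4\<close> by simp
  ultimately show ?thesis
    by linarith
qed

lemma eta_set_of_nu_set:
  assumes "b \<in> nu_set \<Omega>1 \<Omega>2 xb \<delta>"
  obtains a where "a \<in> eta_set \<Omega>1 \<Omega>2 xb \<delta>" "a\<^sup>2 + b\<^sup>2 = 1"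
proof -
  obtain u v where uv: "u \<in> normals_near \<Omega>1 xb \<delta>" "v \<in> normals_near \<Omega>2 xb \<delta>"
      "norm u = 1 / 2" "norm v = 1 / 2" and b: "b = norm (u - v)"
    using assms by (auto simp: nu_set_def)
  have "norm (u + v) \<in> eta_set \<Omega>1 \<Omega>2 xb \<delta>"
    unfolding eta_set_def using uv by force
  with norm_add_half_square[OF uv(3,4)] b show thesis
    using that by blast
qed

text \<open>The alternative \<open>a = 1\<close> covers a pair with a zero vector, which cannot be
  rescaled to norm 1/2; the other vector then has norm 1.\<close>

lemma nu_set_of_eta_set:
  assumes "a \<in> eta_set \<Omega>1 \<Omega>2 xb \<delta>"
  shows "a = 1 \<or> (\<exists>b \<in> nu_set \<Omega>1 \<Omega>2 xb \<delta>. 1 - b\<^sup>2 \<le> a\<^sup>2)"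
proof -
  obtain x y where xy: "x \<in> normals_near \<Omega>1 xb \<delta>" "y \<in> normals_near \<Omega>2 xb \<delta>"
      "norm x + norm y = 1" and a: "a = norm (x + y)"
    using assms by (auto simp: eta_set_def)
  show ?thesis
  proof (cases "x = 0 \<or> y = 0")
    case True
    then show ?thesis
      using xy(3) a by auto
  next
    case False
    \<comment> \<open>Rescaling to norm 1/2 turns \<open>x + y\<close> into the combination with
      coefficients \<open>2 * s\<close> and \<open>2 * t\<close> for \<open>s = norm x\<close>,
      \<open>t = norm y\<close>.\<close>
    define u v where "u = (1 / (2 * norm x)) *\<^sub>R x" and "v = (1 / (2 * norm y)) *\<^sub>R y"
    have "u \<in> normals_near \<Omega>1 xb \<delta>" "v \<in> normals_near \<Omega>2 xb \<delta>"
      unfolding u_def v_def using False xy by (auto intro!: normals_near_scaleR)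
    moreover have uv: "norm u = 1 / 2" "norm v = 1 / 2"
      using False by (simp_all add: u_def v_def)
    ultimately have "norm (u - v) \<in> nu_set \<Omega>1 \<Omega>2 xb \<delta>"
      unfolding nu_set_def by blast
    moreover have "(2 * norm x) *\<^sub>R u + (2 * norm y) *\<^sub>R v = x + y"
      using False by (simp add: u_def v_def)
    then have "1 - (norm (u - v))\<^sup>2 \<le> a\<^sup>2"
      using norm_convex_combination_ge[OF uv xy(3)] a by simp
    ultimately show ?thesis
      by blast
  qed
qed

text \<open>Abbreviations keep these terms syntactically equal to the functions under
  \<open>Lim\<close> in \<open>eta_hat\<close> and \<open>nu_hat\<close>.\<close>

abbreviation eta_fun :: "'a::real_inner set \<Rightarrow> 'a set \<Rightarrow> 'a \<Rightarrow> real \<Rightarrow> real" where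
  "eta_fun \<Omega>1 \<Omega>2 xb \<delta> \<equiv>
     if eta_set \<Omega>1 \<Omega>2 xb \<delta> = {} then 1 else Inf (eta_set \<Omega>1 \<Omega>2 xb \<delta>)"

abbreviation nu_fun :: "'a::real_inner set \<Rightarrow> 'a set \<Rightarrow> 'a \<Rightarrow> real \<Rightarrow> real" where
  "nu_fun \<Omega>1 \<Omega>2 xb \<delta> \<equiv>
     if nu_set \<Omega>1 \<Omega>2 xb \<delta> = {} then 0 else Sup (nu_set \<Omega>1 \<Omega>2 xb \<delta>)"

lemma eta_fun_nonneg: "0 \<le> eta_fun \<Omega>1 \<Omega>2 xb \<delta>"
  by (auto intro!: cInf_greatest intro: eta_set_nonneg)

lemma nu_fun_nonneg: "0 \<le> nu_fun \<Omega>1 \<Omega>2 xb \<delta>"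
proof (cases "nu_set \<Omega>1 \<Omega>2 xb \<delta> = {}")
  case False
  then obtain b where b: "b \<in> nu_set \<Omega>1 \<Omega>2 xb \<delta>"
    by blast
  then have "b \<le> Sup (nu_set \<Omega>1 \<Omega>2 xb \<delta>)"
    using bdd_above_nu_set by (rule cSup_upper)
  with nu_set_bounds(1)[OF b] False show ?thesis
    by auto
qed simp

lemma nu_fun_mono:
  assumes "\<delta> \<le> \<delta>'"
  shows "nu_fun \<Omega>1 \<Omega>2 xb \<delta> \<le> nu_fun \<Omega>1 \<Omega>2 xb \<delta>'"
proof (cases "nu_set \<Omega>1 \<Omega>2 xb \<delta> = {}")
  \<comment> \<open>The default 0 for an empty set respects monotonicity because all values are
    nonnegative.\<close>
  case True
  then show ?thesis
    using nu_fun_nonneg[of \<Omega>1 \<Omega>2 xb \<delta>'] by simp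
next
  case False
  then show ?thesis
    using nu_set_mono[OF assms, of \<Omega>1 \<Omega>2 xb] by (auto intro!: cSup_subset_mono bdd_above_nu_set)
qed

lemma eta_fun_nu_fun_square: "(eta_fun \<Omega>1 \<Omega>2 xb \<delta>)\<^sup>2 + (nu_fun \<Omega>1 \<Omega>2 xb \<delta>)\<^sup>2 = 1"
proof (cases "nu_set \<Omega>1 \<Omega>2 xb \<delta> = {}")
  case True
  \<comment> \<open>Only degenerate pairs are left, so the infimum is 1, by default or attained, and
    matches the default 0 of the supremum.\<close>
  then have "eta_set \<Omega>1 \<Omega>2 xb \<delta> \<subseteq> {1}"
    using nu_set_of_eta_set by blast
  then have "eta_set \<Omega>1 \<Omega>2 xb \<delta> = {} \<or> eta_set \<Omega>1 \<Omega>2 xb \<delta> = {1}"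
    by blast
  with True show ?thesis
    by auto
next
  case False
  let ?E = "eta_set \<Omega>1 \<Omega>2 xb \<delta>" and ?N = "nu_set \<Omega>1 \<Omega>2 xb \<delta>"
  have nonempty: "?E \<noteq> {}"
    using False eta_set_of_nu_set by blast
  have bdd: "bdd_below ?E"
    using eta_set_nonneg by (rule bdd_belowI)
  have E0: "0 \<le> Inf ?E"
    using eta_fun_nonneg[of \<Omega>1 \<Omega>2 xb \<delta>] nonempty by simp
  have N0: "0 \<le> Sup ?N"
    using nu_fun_nonneg[of \<Omega>1 \<Omega>2 xb \<delta>] False by simp
  have le: "Sup ?N \<le> sqrt (1 - (Inf ?E)\<^sup>2)"
  proof (rule cSup_least[OF False])
    fix b assume "b \<in> ?N"
    then obtain a where a: "a \<in> ?E" "a\<^sup>2 + b\<^sup>2 = 1"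
      by (rule eta_set_of_nu_set)
    have "(Inf ?E)\<^sup>2 \<le> a\<^sup>2"
      using E0 by (intro power_mono cInf_lower a(1) bdd)
    with a(2) show "b \<le> sqrt (1 - (Inf ?E)\<^sup>2)"
      by (intro real_le_rsqrt) linarith
  qed
  have ge: "sqrt (1 - (Sup ?N)\<^sup>2) \<le> Inf ?E"
  proof (rule cInf_greatest[OF nonempty])
    fix a assume a: "a \<in> ?E"
    have "1 - (Sup ?N)\<^sup>2 \<le> a\<^sup>2"
      using nu_set_of_eta_set[OF a]
    proof (elim disjE bexE)
      fix b assume b: "b \<in> ?N" "1 - b\<^sup>2 \<le> a\<^sup>2"
      have "b\<^sup>2 \<le> (Sup ?N)\<^sup>2"
        using nu_set_bounds(1)[OF b(1)] by (intro power_mono cSup_upper b(1) bdd_above_nu_set)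
      with b(2) show ?thesis
        by linarith
    qed simp
    then show "sqrt (1 - (Sup ?N)\<^sup>2) \<le> a"
      using eta_set_nonneg[OF a] by (rule real_le_lsqrt[rotated])
  qed
  \<comment> \<open>The real \<open>sqrt\<close> is negative on negative arguments, so this bound
    makes the radicand nonnegative and lets squaring cancel the root.\<close>
  have "0 \<le> sqrt (1 - (Inf ?E)\<^sup>2)"
    using N0 le by linarith
  then have "(sqrt (1 - (Inf ?E)\<^sup>2))\<^sup>2 = 1 - (Inf ?E)\<^sup>2"
    by simp
  moreover have "(Sup ?N)\<^sup>2 \<le> (sqrt (1 - (Inf ?E)\<^sup>2))\<^sup>2"
    using le N0 by (rule power_mono)
  moreover have "1 - (Sup ?N)\<^sup>2 \<le> (Inf ?E)\<^sup>2"
    using ge by (rule sqrt_le_D)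
  ultimately have "(Inf ?E)\<^sup>2 + (Sup ?N)\<^sup>2 = 1"
    by linarith
  with False nonempty show ?thesis
    by simp
qed

theorem theorem2:
  fixes \<Omega>1 \<Omega>2 :: "'a::{real_inner, complete_space} set" and xb :: 'a
  assumes "xb \<in> \<Omega>1 \<inter> \<Omega>2"
  shows "(eta_hat \<Omega>1 \<Omega>2 xb)\<^sup>2 + (nu_hat \<Omega>1 \<Omega>2 xb)\<^sup>2 = 1 \<and>
         1 + c_hat \<Omega>1 \<Omega>2 xb = 2 * (nu_hat \<Omega>1 \<Omega>2 xb)\<^sup>2"
proof -
  define E N where "E = (\<lambda>\<delta>. eta_fun \<Omega>1 \<Omega>2 xb \<delta>)" and "N = (\<lambda>\<delta>. nu_fun \<Omega>1 \<Omega>2 xb \<delta>)"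
  \<comment> \<open>By monotonicity the limit from the right at 0 is the infimum over positive
    arguments; the intersection with \<open>UNIV\<close> is the shape that
    \<open>Lim_right_bound\<close> produces.\<close>
  define L where "L = Inf (N ` ({0<..} \<inter> UNIV))"
  have EN: "(E \<delta>)\<^sup>2 + (N \<delta>)\<^sup>2 = 1" for \<delta>
    unfolding E_def N_def by (rule eta_fun_nu_fun_square)
  have "(N \<longlongrightarrow> L) (at 0 within ({0<..} \<inter> UNIV))"
    unfolding L_def
    by (rule Lim_right_bound[where K = 0]) (simp_all only: N_def nu_fun_mono nu_fun_nonneg)
  then have N: "(N \<longlongrightarrow> L) (at_right 0)"
    by simp
  \<comment> \<open>As a continuous function of \<open>N\<close>, \<open>E\<close> inherits
    convergence from it.\<close>
  have "E = (\<lambda>\<delta>. sqrt (1 - (N \<delta>)\<^sup>2))"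
  proof
    fix \<delta>
    have "(E \<delta>)\<^sup>2 = 1 - (N \<delta>)\<^sup>2"
      using EN[of \<delta>] by linarith
    moreover have "0 \<le> E \<delta>"
      unfolding E_def by (rule eta_fun_nonneg)
    ultimately show "E \<delta> = sqrt (1 - (N \<delta>)\<^sup>2)"
      by (metis real_sqrt_unique)
  qed
  moreover have "((\<lambda>\<delta>. sqrt (1 - (N \<delta>)\<^sup>2)) \<longlongrightarrow> sqrt (1 - L\<^sup>2)) (at_right 0)"
    by (intro tendsto_intros N)
  ultimately have E: "(E \<longlongrightarrow> sqrt (1 - L\<^sup>2)) (at_right 0)"
    by simp
  \<comment> \<open>The function on the left is constantly 1, so uniqueness of limits yields the
    identity for \<open>L\<close> without a separate proof of \<open>L \<le> 1\<close>.\<close>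
  have "((\<lambda>\<delta>. (E \<delta>)\<^sup>2 + (N \<delta>)\<^sup>2) \<longlongrightarrow> (sqrt (1 - L\<^sup>2))\<^sup>2 + L\<^sup>2) (at_right 0)"
    by (intro tendsto_intros E N)
  then have "(sqrt (1 - L\<^sup>2))\<^sup>2 + L\<^sup>2 = 1"
    unfolding EN by (simp add: tendsto_const_iff)
  moreover have "eta_hat \<Omega>1 \<Omega>2 xb = sqrt (1 - L\<^sup>2)"
    unfolding eta_hat_def using E by (intro tendsto_Lim) (simp_all add: E_def)
  moreover have "nu_hat \<Omega>1 \<Omega>2 xb = L"
    unfolding nu_hat_def using N by (intro tendsto_Lim) (simp_all add: N_def)
  ultimately show ?thesis
    by (simp add: c_hat_def)
qed

end
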